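(* Let $\mu$ be a parametrization of $\mathcal{K}_0^n$ with $\mu(\mathcal{K}_0^n)=\mathcal{A}$. Then a convex body $K\in\mathcal{K}_0^n$ is $\mu$-indecomposable if and only if the support $\mathrm{spt}(\mu(K))$ consists exactly of $n+1$ distinct points in $\mathbb{S}^{n-1}$.
   Context: $\mathcal{K}_0^n$ is the class of compact convex sets in $\mathbb{R}^n$ with nonempty interior; $\mathcal{M}^+(\mathbb{S}^{n-1})$ is the class of (finite Borel) positive measures on $\mathbb{S}^{n-1}$. A map $\mu:\mathcal{K}_0^n\to\mathcal{M}^+(\mathbb{S}^{n-1})$ is a parametrization of $\mathcal{K}_0^n$ if (i) the image $\mu(\mathcal{K}_0^n)$ is a convex cone: $\nu_1,\nu_2\in\mu(\mathcal{K}_0^n)$, $t_1,t_2>0$ imply $t_1\nu_1+t_2\nu_2\in\mu(\mathcal{K}_0^n)$; (ii) $\mu$ is injective up to translations: $\mu(K_1)=\mu(K_2)$ if and only if $K_1$ and $K_2$ are translates. $\mathcal{A}$ is the class of Alexandrov measures on $\mathbb{S}^{n-1}$: positive measures on $\mathbb{S}^{n-1}$ which are not concentrated on any equator (intersection of $\mathbb{S}^{n-1}$ with a hyperplane through the origin) and have null barycenter ($\int x\,d\nu(x)=0$). For $K,L\in\mathcal{K}_0^n$ and $t>0$, $K+_\mu L$ and $t\cdot_\mu K$ are the convex bodies in $\mathcal{K}_0^n$, determined up to translation, such that $\mu(K+_\mu L)=\mu(K)+\mu(L)$ and $\mu(t\cdot_\mu K)=t\,\mu(K)$. $K\in\mathcal{K}_0^n$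 is $\mu$-indecomposable if the equality $K=K'+_\mu K''$ (up to translation, with $K',K''\in\mathcal{K}_0^n$) implies that $K'$ and $K''$ are $\mu$-scalar multiples of $K$, i.e. (up to translation) $K'=t'\cdot_\mu K$ and $K''=t''\cdot_\mu K$ for some $t',t''>0$. *)

theory Defs
  imports "HOL-Analysis.Analysis"
begin

definition convex_bodies :: "'a::euclidean_space set set" where
  "convex_bodies = {K. compact K \<and> convex K \<and> interior K \<noteq> {}}"

definition translates :: "'a::euclidean_space set \<Rightarrow> 'a set \<Rightarrow> bool" where
  "translates K L \<longleftrightarrow> (\<exists>a. L = (\<lambda>x. a + x) ` K)"

definition sphere_measures :: "'a::euclidean_space measure set" where
  "sphere_measures =
     {M. sets M = sets (restrict_space borel (sphere 0 1)) \<and> finite_measure M}"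

text \<open>Sum of two measures on the same measurable space; multiples are the library's
  \<^const>\<open>scale_measure\<close>. The lemmas below show that, for measures with the same measurable
  sets, the value on every set is the sum of the two values.\<close>

definition add_measure :: "'a measure \<Rightarrow> 'a measure \<Rightarrow> 'a measure" where
  "add_measure M N = measure_of (space M) (sets M) (\<lambda>A. emeasure M A + emeasure N A)"

lemma space_add_measure [simp]: "space (add_measure M N) = space M"
  by (simp add: add_measure_def)

lemma sets_add_measure [simp]: "sets (add_measure M N) = sets M"
  by (simp add: add_measure_def)

lemma emeasure_add_measure:
  assumes "sets N = sets M"
  shows "emeasure (add_measure M N) A = emeasure M A + emeasure N A"
proof (cases "A \<in> sets M")
  case True
  show ?thesis unfolding add_measure_def
  proof (rule emeasure_measure_of_sigma)
    show "sigma_algebra (space M) (sets M)" ..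
    show "positive (sets M) (\<lambda>A. emeasure M A + emeasure N A)"
      by (simp add: positive_def)
    show "countably_additive (sets M) (\<lambda>A. emeasure M A + emeasure N A)"
    proof (rule countably_additiveI)
      fix F :: "nat \<Rightarrow> _"
      assume F: "range F \<subseteq> sets M" "disjoint_family F"
      have "(\<Sum>i. emeasure M (F i) + emeasure N (F i))
          = (\<Sum>i. emeasure M (F i)) + (\<Sum>i. emeasure N (F i))"
        by (rule suminf_add [symmetric]) auto
      also have "\<dots> = emeasure M (\<Union>i. F i) + emeasure N (\<Union>i. F i)"
        using F assms by (simp add: suminf_emeasure)
      finally show "(\<Sum>i. emeasure M (F i) + emeasure N (F i))
          = emeasure M (\<Union>i. F i) + emeasure N (\<Union>i. F i)" .
    qed
    show "A \<in> sets M" by fact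
  qed
next
  case False
  then show ?thesis by (simp add: emeasure_notin_sets assms)
qed

definition parametrization :: "('a::euclidean_space set \<Rightarrow> 'a measure) \<Rightarrow> bool" where
  "parametrization \<mu> \<longleftrightarrow>
     \<mu> ` convex_bodies \<subseteq> sphere_measures \<and>
     (\<forall>\<nu>1\<in>\<mu> ` convex_bodies. \<forall>\<nu>2\<in>\<mu> ` convex_bodies. \<forall>t1 t2::real. t1 > 0 \<longrightarrow> t2 > 0 \<longrightarrow>
        add_measure (scale_measure (ennreal t1) \<nu>1) (scale_measure (ennreal t2) \<nu>2)
          \<in> \<mu> ` convex_bodies) \<and>
     (\<forall>K1\<in>convex_bodies. \<forall>K2\<in>convex_bodies. \<mu> K1 = \<mu> K2 \<longleftrightarrow> translates K1 K2)"

definition alexandrov_measures :: "'a::euclidean_space measure set" where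
  "alexandrov_measures =
     {\<nu>\<in>sphere_measures.
        (\<forall>u. u \<noteq> 0 \<longrightarrow> emeasure \<nu> (sphere 0 1 - {x. u \<bullet> x = 0}) \<noteq> 0) \<and>
        (\<integral>x. x \<partial>\<nu>) = 0}"

text \<open>The bodies \<open>K +\<^sub>\<mu> L\<close> and \<open>t \<cdot>\<^sub>\<mu> K\<close> are determined only up to translation; the
  following pick a representative, so they are meant to be compared with other bodies only
  through \<^const>\<open>translates\<close>. For a parametrization \<open>\<mu>\<close>, bodies \<open>K\<close>, \<open>L\<close> and \<open>t > 0\<close>, a
  representative exists because the image of \<open>\<mu>\<close> is a convex cone.\<close>

definition param_add ::
  "('a::euclidean_space set \<Rightarrow> 'a measure) \<Rightarrow> 'a set \<Rightarrow> 'a set \<Rightarrow> 'a set" where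
  "param_add \<mu> K L = (SOME M. M \<in> convex_bodies \<and> \<mu> M = add_measure (\<mu> K) (\<mu> L))"

definition param_scale ::
  "('a::euclidean_space set \<Rightarrow> 'a measure) \<Rightarrow> real \<Rightarrow> 'a set \<Rightarrow> 'a set" where
  "param_scale \<mu> t K = (SOME M. M \<in> convex_bodies \<and> \<mu> M = scale_measure (ennreal t) (\<mu> K))"

definition param_indecomposable ::
  "('a::euclidean_space set \<Rightarrow> 'a measure) \<Rightarrow> 'a set \<Rightarrow> bool" where
  "param_indecomposable \<mu> K \<longleftrightarrow>
     (\<forall>K'\<in>convex_bodies. \<forall>K''\<in>convex_bodies. translates K (param_add \<mu> K' K'') \<longrightarrow>
        (\<exists>t'>0. translates K' (param_scale \<mu> t' K)) \<and>
        (\<exists>t''>0. translates K'' (param_scale \<mu> t'' K)))"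

definition measure_support :: "'a::topological_space measure \<Rightarrow> 'a set" where
  "measure_support M =
     {x\<in>space M. \<forall>U. open U \<longrightarrow> x \<in> U \<longrightarrow> emeasure M (U \<inter> space M) \<noteq> 0}"

end

theory Submission
  imports Defs
begin

text \<open>
  The bodies only serve as labels: since \<open>\<mu>\<close> is injective up to translation and its image is a
  convex cone, \<open>K\<close> is \<open>\<mu>\<close>-indecomposable exactly when \<open>M = \<mu> K\<close> spans an extreme ray of the cone
  of Alexandrov measures, that is, when every splitting \<open>M = N\<^sub>1 + N\<^sub>2\<close> in that cone consists of
  positive multiples of \<open>M\<close> (\<open>param_indecomposable_iff_measures\<close>). What remains is a statement
  about measures in a Euclidean space of dimension \<open>d\<close> (\<open>alexandrov_indecomposable_iff\<close>).

  Since \<open>M\<close> lives on no hyperplane through the origin, its support spans the space. If the support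
  is finite, the null barycenter is a linear relation between the support points, whose
  coefficients are the point masses. Hence \<open>d\<close> or fewer support points are impossible: they would
  be a basis, and all masses would vanish. For \<open>d + 1\<close> spanning points the linear relations form
  a line; a summand of \<open>M\<close> lives on the same points, so its masses are proportional to those
  of \<open>M\<close> (\<open>alexandrov_summand_of_simplex_support\<close>).

  If the support contains \<open>d + 2\<close> points, choose disjoint balls around them and leave one ball out.
  The first moments of \<open>M\<close> over the other \<open>d + 1\<close> balls are linearly dependent, so some step
  function \<open>g\<close> on these balls, not almost everywhere zero, satisfies \<open>\<integral> g(x) x dM = 0\<close>. After scaling
  \<open>g\<close> to be small, the densities \<open>1/2 + g\<close> and \<open>1/2 - g\<close> split \<open>M\<close> into two Alexandrov measures.
  They are not multiples of \<open>M\<close>, because \<open>g\<close> vanishes on the ball that was left out but not on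
  all others (\<open>alexandrov_decomposition_of_large_support\<close>).
\<close>

section \<open>Measures on the sphere and their supports\<close>

lemma sphere_measuresD:
  fixes M :: "'a::euclidean_space measure"
  assumes "M \<in> sphere_measures"
  shows "space M = sphere 0 1" "finite_measure M"
    "sets M = sets (restrict_space borel (sphere 0 1))"
    "\<And>f :: 'a \<Rightarrow> 'b::topological_space. f \<in> borel_measurable borel \<Longrightarrow> f \<in> borel_measurable M"
    "\<And>B. B \<in> sets borel \<Longrightarrow> B \<inter> sphere 0 1 \<in> sets M"
proof -
  show s: "sets M = sets (restrict_space borel (sphere 0 1))" and "finite_measure M"
    using assms by (auto simp: sphere_measures_def)
  show "space M = sphere 0 1"
    using sets_eq_imp_space_eq[OF s] by (simp add: space_restrict_space)
  show "f \<in> borel_measurable M" if "f \<in> borel_measurable borel" for f :: "'a \<Rightarrow> 'b"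
    using measurable_restrict_space1[OF that] s by (simp cong: measurable_cong_sets)
  show "B \<inter> sphere 0 1 \<in> sets M" if "B \<in> sets borel" for B
    unfolding s using that by (auto simp: sets_restrict_space)
qed

text \<open>Each point outside the support has a null open neighbourhood; by the Lindelof property
  countably many of these cover the complement.\<close>

lemma null_sets_outside_support:
  fixes M :: "'a::euclidean_space measure"
  assumes M: "M \<in> sphere_measures"
  shows "sphere 0 1 - measure_support M \<in> null_sets M"
proof -
  note MD = sphere_measuresD[OF M]
  define F where "F = {U :: 'a set. open U \<and> emeasure M (U \<inter> space M) = 0}"
  obtain F' where F': "F' \<subseteq> F" "countable F'" "\<Union>F' = \<Union>F"
    using Lindelof[of F] by (auto simp: F_def)
  have "(\<Union>U\<in>F'. U \<inter> space M) \<in> null_sets M"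
  proof (rule null_sets_UN'[OF F'(2)])
    fix U assume "U \<in> F'"
    then have "open U" "emeasure M (U \<inter> space M) = 0" using F'(1) by (auto simp: F_def)
    then show "U \<inter> space M \<in> null_sets M" using MD(5)[of U] by (auto simp: null_sets_def MD(1))
  qed
  also have "(\<Union>U\<in>F'. U \<inter> space M) = sphere 0 1 - measure_support M"
    using F'(3) by (auto simp: measure_support_def F_def MD(1))
  finally show ?thesis .
qed

lemma emeasure_finite_carrier:
  fixes M :: "'a::euclidean_space measure"
  assumes M: "M \<in> sphere_measures" and S: "finite S" "S \<subseteq> sphere 0 1"
    and null: "sphere 0 1 - S \<in> null_sets M" and B: "B \<in> sets M"
  shows "emeasure M B = ennreal (\<Sum>s\<in>S \<inter> B. measure M {s})"
proof -
  note MD = sphere_measuresD[OF M]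
  interpret finite_measure M by (rule MD(2))
  have sing: "{s} \<in> sets M" if "s \<in> S" for s
    using MD(5)[of "{s}"] S that by (auto simp: Int_absorb2)
  have sub: "B \<subseteq> sphere 0 1" using sets.sets_into_space[OF B] by (simp add: MD(1))
  have SB: "S \<inter> B \<in> sets M"
    using MD(5)[of S] S B by (auto simp: Int_absorb2 finite_imp_closed)
  have "emeasure M B = emeasure M (S \<inter> B)"
    by (rule emeasure_eq_AE)
      (use AE_not_in[OF null] sub B SB in \<open>auto elim!: eventually_mono simp: MD(1)\<close>)
  also have "\<dots> = (\<Sum>s\<in>S \<inter> B. emeasure M {s})"
    using S sing by (intro emeasure_eq_sum_singleton) auto
  finally show ?thesis by (simp add: emeasure_eq_measure)
qed

lemma integrable_id_sphere:
  fixes M :: "'a::euclidean_space measure"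
  assumes M: "M \<in> sphere_measures"
  shows "integrable M (\<lambda>x. x)"
proof -
  interpret finite_measure M by (rule sphere_measuresD(2)[OF M])
  show ?thesis
    by (rule integrable_const_bound[where B = 1])
      (auto simp: sphere_measuresD[OF M] intro: sphere_measuresD(4)[OF M])
qed

lemma barycenter_finite_carrier:
  fixes M :: "'a::euclidean_space measure"
  assumes M: "M \<in> sphere_measures" and S: "finite S" "S \<subseteq> sphere 0 1"
    and null: "sphere 0 1 - S \<in> null_sets M"
  shows "(\<integral>x. x \<partial>M) = (\<Sum>s\<in>S. measure M {s} *\<^sub>R s)"
proof -
  note MD = sphere_measuresD[OF M]
  interpret finite_measure M by (rule MD(2))
  have sing: "{s} \<in> sets M" if "s \<in> S" for s
    using MD(5)[of "{s}"] S that by (auto simp: Int_absorb2)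
  have "(\<integral>x. x \<partial>M) = (\<integral>x. (\<Sum>s\<in>S. indicator {s} x *\<^sub>R s) \<partial>M)"
  proof (rule integral_cong_AE)
    show "AE x in M. x = (\<Sum>s\<in>S. indicator {s} x *\<^sub>R s)"
      using AE_not_in[OF null] AE_space
    proof eventually_elim
      case (elim x)
      then have "x \<in> S" by (auto simp: MD(1))
      then have "(\<Sum>s\<in>S. indicator {s} x *\<^sub>R s) = (\<Sum>s\<in>S. if s = x then s else 0)"
        by (intro sum.cong) (auto simp: indicator_def)
      with \<open>x \<in> S\<close> show ?case using S by simp
    qed
  qed (auto intro!: MD(4) borel_measurable_sum borel_measurable_scaleR borel_measurable_indicator)
  also have "\<dots> = (\<Sum>s\<in>S. \<integral>x. indicator {s} x *\<^sub>R s \<partial>M)"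
    by (rule Bochner_Integration.integral_sum) (use sing in \<open>auto simp: emeasure_eq_measure\<close>)
  also have "\<dots> = (\<Sum>s\<in>S. measure M {s} *\<^sub>R s)"
  proof (rule sum.cong[OF refl])
    fix s assume s: "s \<in> S"
    have "integrable M (indicator {s} :: 'a \<Rightarrow> real)"
      using sing[OF s] by (simp add: integrable_indicator_iff emeasure_eq_measure)
    then have "(\<integral>x. indicator {s} x *\<^sub>R s \<partial>M) = (\<integral>x. indicator {s} x \<partial>M) *\<^sub>R s"
      by (intro integral_scaleR_left)
    moreover have "{s} \<inter> space M = {s}" using s S(2) by (auto simp: MD(1))
    ultimately show "(\<integral>x. indicator {s} x *\<^sub>R s \<partial>M) = measure M {s} *\<^sub>R s" by simp
  qed
  finally show ?thesis .
qed

section \<open>Alexandrov measures\<close>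

text \<open>Otherwise a vector orthogonal to \<open>S\<close> defines an equator that contains \<open>S\<close>, and the measure
  would be concentrated on it.\<close>

lemma alexandrov_null_carrier_spans:
  fixes M :: "'a::euclidean_space measure"
  assumes M: "M \<in> alexandrov_measures" and null: "sphere 0 1 - S \<in> null_sets M"
  shows "span S = UNIV"
proof (rule ccontr)
  assume "span S \<noteq> UNIV"
  then obtain u where u: "u \<noteq> 0" "\<And>x. x \<in> span S \<Longrightarrow> u \<bullet> x = 0"
    using span_not_UNIV_orthogonal by blast
  have "sphere 0 1 - {x. u \<bullet> x = 0} \<subseteq> sphere 0 1 - S"
    using u(2) span_base by blast
  then have "emeasure M (sphere 0 1 - {x. u \<bullet> x = 0}) \<le> emeasure M (sphere 0 1 - S)"
    using null by (intro emeasure_mono) auto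
  then show False using M u(1) null by (auto simp: alexandrov_measures_def)
qed

lemma alexandrov_nonzero:
  fixes M :: "'a::euclidean_space measure"
  assumes "M \<in> alexandrov_measures"
  shows "emeasure M (sphere 0 1) \<noteq> 0"
proof
  assume "emeasure M (sphere 0 1) = 0"
  moreover have "sphere 0 1 \<in> sets M"
    using assms sphere_measuresD(1)[of M] sets.top[of M] by (auto simp: alexandrov_measures_def)
  ultimately have "sphere 0 1 - {} \<in> null_sets M" by auto
  from alexandrov_null_carrier_spans[OF assms this] show False
    by (metis UNIV_not_singleton span_empty)
qed

section \<open>Linear relations between vectors\<close>

lemma coefficients_zero_of_independent:
  fixes S :: "'a::real_vector set"
  assumes "finite S" "independent S" "(\<Sum>s\<in>S. a s *\<^sub>R s) = 0" "s \<in> S"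
  shows "a s = 0"
  using assms by (metis independentD order_refl)

text \<open>As \<open>c s0 \<noteq> 0\<close>, the point \<open>s0\<close> is a combination of the others, which therefore form a basis. The
  relation \<open>a - (a s0 / c s0) c\<close> has coefficient zero at \<open>s0\<close>, so it is trivial.\<close>

lemma linear_relations_proportional:
  fixes S :: "'a::euclidean_space set"
  assumes S: "finite S" "card S = DIM('a) + 1" "span S = UNIV"
    and c: "(\<Sum>s\<in>S. c s *\<^sub>R s) = 0" "s0 \<in> S" "c s0 \<noteq> 0"
    and a: "(\<Sum>s\<in>S. a s *\<^sub>R s) = 0" and s: "s \<in> S"
  shows "a s = a s0 / c s0 * c s"
proof -
  let ?S = "S - {s0}"
  define b where "b s = a s - a s0 / c s0 * c s" for s
  have b0: "b s0 = 0" using c by (simp add: b_def)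
  have "(\<Sum>s\<in>S. b s *\<^sub>R s) = (\<Sum>s\<in>S. a s *\<^sub>R s) - (a s0 / c s0) *\<^sub>R (\<Sum>s\<in>S. c s *\<^sub>R s)"
    by (simp add: b_def scaleR_sum_right sum_subtractf scaleR_left_diff_distrib)
  then have bsum: "(\<Sum>s\<in>?S. b s *\<^sub>R s) = 0"
    using a c S b0 by (simp add: sum.remove[of S s0])
  have "c s0 *\<^sub>R s0 = - (\<Sum>s\<in>?S. c s *\<^sub>R s)"
    using c S by (simp add: sum.remove[of S s0] eq_neg_iff_add_eq_0)
  then have "s0 = (- 1 / c s0) *\<^sub>R (\<Sum>s\<in>?S. c s *\<^sub>R s)"
    using c(3) by (metis (no_types, lifting) divide_minus_left scaleR_minus_left
        scaleR_minus_right scaleR_one scaleR_scaleR nonzero_divide_eq_eq)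
  moreover have "\<dots> \<in> span ?S"
    by (intro span_scale span_sum) (auto intro: span_base)
  ultimately have "s0 \<in> span ?S" by metis
  then have "span ?S = UNIV"
    using S(3) span_redundant[of s0 ?S] c(2) by (simp add: insert_absorb)
  then have "independent ?S"
    using S c(2) by (intro card_le_dim_spanning[of _ UNIV]) auto
  then have "b s = 0" if "s \<in> ?S"
    using coefficients_zero_of_independent[OF _ _ bsum that] S by auto
  then have "b s = 0" using b0 s by auto
  then show ?thesis by (simp add: b_def)
qed

text \<open>The vectors are indexed, not collected in a set, because first moments over different balls may
  coincide; a coincidence \<open>v i = v j\<close> is itself a relation.\<close>

lemma nontrivial_relation_of_card:
  fixes v :: "'i \<Rightarrow> 'a::euclidean_space"
  assumes I: "finite I" "card I > DIM('a)"
  obtains a i where "i \<in> I" "a i \<noteq> 0" "(\<Sum>i\<in>I. a i *\<^sub>R v i) = 0"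
proof (cases "inj_on v I")
  case True
  then have "card (v ` I) > DIM('a)" using I by (simp add: card_image)
  then have "dependent (v ` I)" using independent_bound by (metis not_le)
  then obtain b w where b: "w \<in> v ` I" "b w \<noteq> 0" "(\<Sum>w\<in>v ` I. b w *\<^sub>R w) = 0"
    using I by (auto simp: dependent_finite)
  then show thesis
    using that[of _ "b \<circ> v"] sum.reindex[OF True, of "\<lambda>w. b w *\<^sub>R w"] by auto
next
  case False
  then obtain i j where ij: "i \<in> I" "j \<in> I" "i \<noteq> j" "v i = v j" by (auto simp: inj_on_def)
  define a where "a = (\<lambda>k. if k = i then 1 else if k = j then - 1 else 0 :: real)"
  have "(\<Sum>k\<in>I. a k *\<^sub>R v k) = (\<Sum>k\<in>{i, j}. a k *\<^sub>R v k)"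
    using I ij by (intro sum.mono_neutral_right) (auto simp: a_def)
  also have "\<dots> = 0" using ij by (simp add: a_def)
  finally show thesis using that[of i a] ij by (simp add: a_def)
qed

section \<open>Extreme rays of the cone of Alexandrov measures\<close>

lemma finite_disjoint_balls:
  fixes T :: "'a::metric_space set"
  assumes "finite T"
  obtains r where "r > 0" "\<And>x y. x \<in> T \<Longrightarrow> y \<in> T \<Longrightarrow> x \<noteq> y \<Longrightarrow> ball x r \<inter> ball y r = {}"
proof -
  define D where "D = insert 1 ((\<lambda>(x, y). dist x y) ` {p \<in> T \<times> T. fst p \<noteq> snd p})"
  have D: "finite D" "D \<noteq> {}" using assms by (auto simp: D_def)
  have "Min D > 0" using D by (auto simp: D_def)
  moreover have "ball x (Min D / 2) \<inter> ball y (Min D / 2) = {}"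
    if "x \<in> T" "y \<in> T" "x \<noteq> y" for x y
  proof -
    have "Min D \<le> dist x y" using D(1) that by (intro Min_le) (auto simp: D_def)
    then show ?thesis by (intro disjoint_ballI) simp
  qed
  ultimately show thesis using that[of "Min D / 2"] by auto
qed

text \<open>A positive density does not change the null sets, so the new measure is still not
  concentrated on an equator.\<close>

lemma alexandrov_density:
  fixes M :: "'a::euclidean_space measure"
  assumes M: "M \<in> alexandrov_measures" and f: "f \<in> borel_measurable borel"
    and bounds: "\<And>x. 0 < f x" "\<And>x. f x \<le> C"
    and bary: "(\<integral>x. f x *\<^sub>R x \<partial>M) = 0"
  shows "density M (\<lambda>x. ennreal (f x)) \<in> alexandrov_measures" (is "?D \<in> _")
proof -
  have MS: "M \<in> sphere_measures" using M by (auto simp: alexandrov_measures_def)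
  note MD = sphere_measuresD[OF MS]
  interpret finite_measure M by (rule MD(2))
  have fM: "f \<in> borel_measurable M" by (rule MD(4)[OF f])
  have "emeasure ?D (space ?D) = (\<integral>\<^sup>+x. ennreal (f x) * indicator (space M) x \<partial>M)"
    using fM by (simp add: emeasure_density)
  also have "\<dots> \<le> (\<integral>\<^sup>+x. ennreal C \<partial>M)"
    using bounds(2) by (intro nn_integral_mono) (auto intro!: ennreal_leI split: split_indicator)
  also have "\<dots> < \<infinity>" by (simp add: ennreal_mult_less_top emeasure_eq_measure)
  finally have DS: "?D \<in> sphere_measures"
    by (auto simp: sphere_measures_def MD(3) intro!: finite_measureI)
  have "emeasure ?D (sphere 0 1 - {x. u \<bullet> x = 0}) \<noteq> 0" if "u \<noteq> 0" for u
  proof -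
    let ?E = "sphere 0 1 - {x. u \<bullet> x = 0}"
    have "open (- {x. u \<bullet> x = 0})"
      using closed_hyperplane[of u 0] by (simp add: open_Compl)
    then have E: "?E \<in> sets M"
      using MD(5)[of "- {x. u \<bullet> x = 0}"] by (simp add: Diff_eq Int_commute)
    have "?E \<in> null_sets ?D \<longleftrightarrow> ?E \<in> null_sets M"
    proof -
      have "?E \<in> null_sets M" if "AE x in M. x \<in> ?E \<longrightarrow> ennreal (f x) = 0"
      proof -
        from that have "AE x in M. x \<notin> ?E"
          by eventually_elim (metis bounds(1) ennreal_eq_0_iff not_le)
        then show ?thesis using E by (simp add: AE_iff_null_sets)
      qed
      moreover have "AE x in M. x \<in> ?E \<longrightarrow> ennreal (f x) = 0" if "?E \<in> null_sets M"
        using AE_not_in[OF that] by eventually_elim auto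
      ultimately show ?thesis using fM E by (auto simp: null_sets_density_iff)
    qed
    moreover have "emeasure M ?E \<noteq> 0" using M \<open>u \<noteq> 0\<close> by (auto simp: alexandrov_measures_def)
    ultimately show ?thesis using E by (auto simp: null_sets_def)
  qed
  moreover have "(\<integral>x. x \<partial>?D) = 0"
    using fM bounds(1) bary MD(4)[of "\<lambda>x. x"]
    by (subst integral_density) (auto simp: less_imp_le)
  ultimately show ?thesis using DS by (auto simp: alexandrov_measures_def)
qed

text \<open>A measure below \<open>M\<close> has no mass outside the support of \<open>M\<close>, so both barycenter
  conditions are linear relations between the same points, and these relations form a line.\<close>

lemma alexandrov_summand_of_simplex_support:
  fixes M :: "'a::euclidean_space measure"
  assumes M: "M \<in> alexandrov_measures"
    and S: "finite (measure_support M)" "card (measure_support M) = DIM('a) + 1"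
    and N: "N \<in> alexandrov_measures" and le: "\<And>A. emeasure N A \<le> emeasure M A"
  shows "\<exists>t>0. N = scale_measure (ennreal t) M"
proof -
  let ?S = "measure_support M"
  have MS: "M \<in> sphere_measures" and NS: "N \<in> sphere_measures"
    using M N by (auto simp: alexandrov_measures_def)
  note MD = sphere_measuresD[OF MS] and ND = sphere_measuresD[OF NS]
  have sub: "?S \<subseteq> sphere 0 1" by (auto simp: measure_support_def MD(1))
  have nullM: "sphere 0 1 - ?S \<in> null_sets M" by (rule null_sets_outside_support[OF MS])
  have nullN: "sphere 0 1 - ?S \<in> null_sets N"
    using nullM le[of "sphere 0 1 - ?S"] by (auto simp: null_sets_def MD(3) ND(3))
  have spn: "span ?S = UNIV" by (rule alexandrov_null_carrier_spans[OF M nullM])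
  note eM = emeasure_finite_carrier[OF MS S(1) sub nullM]
    and eN = emeasure_finite_carrier[OF NS S(1) sub nullN]
  have top: "sphere 0 1 \<in> sets M"
    using sets.top[of M] by (simp add: MD(1))
  have "(\<Sum>s\<in>?S. measure M {s}) \<noteq> 0"
    using alexandrov_nonzero[OF M] eM[OF top] sub by (auto simp: Int_absorb2)
  then obtain s0 where s0: "s0 \<in> ?S" "measure M {s0} \<noteq> 0" by (meson sum.neutral)
  define t where "t = measure N {s0} / measure M {s0}"
  have rel: "(\<Sum>s\<in>?S. measure M {s} *\<^sub>R s) = 0" "(\<Sum>s\<in>?S. measure N {s} *\<^sub>R s) = 0"
    using M N barycenter_finite_carrier[OF MS S(1) sub nullM]
      barycenter_finite_carrier[OF NS S(1) sub nullN]
    by (auto simp: alexandrov_measures_def)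
  have eq: "measure N {s} = t * measure M {s}" if "s \<in> ?S" for s
    unfolding t_def
    by (rule linear_relations_proportional[OF S spn rel(1) s0 rel(2) that])
  have t0: "t \<ge> 0" by (simp add: t_def)
  have N_eq: "N = scale_measure (ennreal t) M"
  proof (rule measure_eqI)
    show "sets N = sets (scale_measure (ennreal t) M)" by (simp add: MD(3) ND(3))
    fix A assume A: "A \<in> sets N"
    then have A': "A \<in> sets M" by (simp add: MD(3) ND(3))
    show "emeasure N A = emeasure (scale_measure (ennreal t) M) A"
      using t0 eq by (simp add: eM[OF A'] eN[OF A] sum_distrib_left ennreal_mult'[symmetric])
  qed
  have "t \<noteq> 0"
  proof
    assume "t = 0"
    then have "emeasure N (sphere 0 1) = 0" by (subst N_eq) simp
    then show False using alexandrov_nonzero[OF N] by simp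
  qed
  with t0 have "t > 0" by simp
  with N_eq show ?thesis by blast
qed

text \<open>A spanning set of at most \<open>DIM('a)\<close> points is linearly independent, and the barycenter
  relation would force every point mass to vanish.\<close>

lemma alexandrov_support_lower_bound:
  fixes M :: "'a::euclidean_space measure"
  assumes M: "M \<in> alexandrov_measures" and S: "finite (measure_support M)"
  shows "card (measure_support M) > DIM('a)"
proof (rule ccontr)
  let ?S = "measure_support M"
  assume "\<not> card ?S > DIM('a)"
  have MS: "M \<in> sphere_measures" using M by (auto simp: alexandrov_measures_def)
  note MD = sphere_measuresD[OF MS]
  have sub: "?S \<subseteq> sphere 0 1" by (auto simp: measure_support_def MD(1))
  have null: "sphere 0 1 - ?S \<in> null_sets M" by (rule null_sets_outside_support[OF MS])
  have "span ?S = UNIV" by (rule alexandrov_null_carrier_spans[OF M null])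
  then have ind: "independent ?S"
    using S \<open>\<not> card ?S > DIM('a)\<close> by (intro card_le_dim_spanning[of _ UNIV]) auto
  have "(\<Sum>s\<in>?S. measure M {s} *\<^sub>R s) = 0"
    using M barycenter_finite_carrier[OF MS S sub null] by (auto simp: alexandrov_measures_def)
  then have "measure M {s} = 0" if "s \<in> ?S" for s
    using that by (rule coefficients_zero_of_independent[OF S ind])
  moreover have "sphere 0 1 \<in> sets M" using sets.top[of M] by (simp add: MD(1))
  ultimately have "emeasure M (sphere 0 1) = 0"
    using emeasure_finite_carrier[OF MS S sub null, of "sphere 0 1"] by simp
  then show False using alexandrov_nonzero[OF M] by simp
qed

text \<open>The first moments over all but one of the disjoint balls around the points of \<open>T\<close> satisfy a
  nontrivial linear relation, which gives a step function \<open>g\<close> that perturbs the density \<open>1/2\<close> without moving the barycenter. The last ball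
  is kept free so that a multiple of \<open>M\<close> would need the factor \<open>1/2\<close>.\<close>

lemma alexandrov_decomposition_of_large_support:
  fixes M :: "'a::euclidean_space measure"
  assumes M: "M \<in> alexandrov_measures"
    and T: "T \<subseteq> measure_support M" "finite T" "card T = DIM('a) + 2"
  shows "\<exists>N1\<in>alexandrov_measures. \<exists>N2\<in>alexandrov_measures.
    M = add_measure N1 N2 \<and> (\<nexists>t. t > 0 \<and> N1 = scale_measure (ennreal t) M)"
proof -
  have MS: "M \<in> sphere_measures" using M by (auto simp: alexandrov_measures_def)
  note MD = sphere_measuresD[OF MS]
  interpret finite_measure M by (rule MD(2))
  obtain r where r: "r > 0"
    "\<And>x y. x \<in> T \<Longrightarrow> y \<in> T \<Longrightarrow> x \<noteq> y \<Longrightarrow> ball x r \<inter> ball y r = {}"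
    using finite_disjoint_balls[OF T(2)] by metis
  have same_centre: "s = s'"
    if "s \<in> T" "s' \<in> T" "x \<in> ball s r" "x \<in> ball s' r" for s s' x
    using r(2)[OF that(1,2)] that(3,4) by blast
  define B where "B s = ball s r \<inter> sphere 0 1" for s :: 'a
  have B_sets: "B s \<in> sets M" for s unfolding B_def by (rule MD(5)) simp
  have B_pos: "measure M (B s) > 0" if "s \<in> T" for s
  proof -
    have "emeasure M (ball s r \<inter> space M) \<noteq> 0"
      using T(1) that r(1) by (auto simp: measure_support_def)
    then show ?thesis by (simp add: B_def MD(1) emeasure_eq_measure zero_less_measure_iff)
  qed
  obtain p where p: "p \<in> T" using T by fastforce
  have card_I: "card (T - {p}) > DIM('a)" using p T by simp
  obtain a q where q: "q \<in> T - {p}" "a q \<noteq> 0"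
    and rel: "(\<Sum>s\<in>T - {p}. a s *\<^sub>R (\<integral>x. indicator (ball s r) x *\<^sub>R x \<partial>M)) = 0"
    by (rule nontrivial_relation_of_card[OF finite_Diff[OF T(2)] card_I])
  \<comment> \<open>The factor \<open>c\<close> makes \<open>g\<close> at most \<open>1/4\<close> in absolute value, so \<open>1/2 + g\<close> and \<open>1/2 - g\<close> are
    positive densities; the summand 1 keeps the denominator positive.\<close>
  define c where "c = 1 / (4 * (1 + (\<Sum>s\<in>T - {p}. \<bar>a s\<bar>)))"
  have sum_nn: "(\<Sum>s\<in>T - {p}. \<bar>a s\<bar>) \<ge> 0" by (rule sum_nonneg) simp
  then have "4 * (1 + (\<Sum>s\<in>T - {p}. \<bar>a s\<bar>)) > 0"
    by (intro mult_pos_pos add_pos_nonneg) simp_all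
  then have c: "c > 0" "c * (\<Sum>s\<in>T - {p}. \<bar>a s\<bar>) \<le> 1 / 4"
    by (simp_all add: c_def field_simps)
  define g where "g x = c * (\<Sum>s\<in>T - {p}. a s * indicator (ball s r) x)" for x :: 'a
  have g_meas: "g \<in> borel_measurable borel" unfolding g_def
    by (intro borel_measurable_times borel_measurable_sum borel_measurable_const
        borel_measurable_indicator) simp
  have g_bound: "\<bar>g x\<bar> \<le> 1 / 4" for x
  proof -
    have "\<bar>\<Sum>s\<in>T - {p}. a s * indicator (ball s r) x\<bar> \<le> (\<Sum>s\<in>T - {p}. \<bar>a s\<bar>)"
      by (rule order_trans[OF sum_abs sum_mono]) (auto simp: indicator_def)
    then have "\<bar>g x\<bar> \<le> c * (\<Sum>s\<in>T - {p}. \<bar>a s\<bar>)"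
      using c(1) by (simp add: g_def abs_mult)
    with c(2) show ?thesis by simp
  qed
  have g_p: "g x = 0" if "x \<in> B p" for x
  proof -
    have "indicator (ball s r) x = (0 :: real)" if "s \<in> T - {p}" for s
      using same_centre[of s p x] that p \<open>x \<in> B p\<close>
      by (auto simp: B_def indicator_def simp del: mem_ball)
    then show ?thesis by (simp add: g_def)
  qed
  have g_q: "g x = c * a q" if "x \<in> B q" for x
  proof -
    have "(\<Sum>s\<in>T - {p}. a s * indicator (ball s r) x) = (\<Sum>s\<in>T - {p}. if s = q then a s else 0)"
      using that same_centre[of _ q x] q
      by (intro sum.cong) (auto simp: B_def indicator_def simp del: mem_ball)
    then show ?thesis using q T by (simp add: g_def)
  qed
  have int_ball: "integrable M (\<lambda>x. indicator (ball s r) x *\<^sub>R x)" for s :: 'a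
    by (rule Bochner_Integration.integrable_bound[OF integrable_id_sphere[OF MS]])
      (auto intro!: MD(4) borel_measurable_scaleR borel_measurable_indicator
        split: split_indicator)
  have g_eq: "g x *\<^sub>R x = (\<Sum>s\<in>T - {p}. (c * a s) *\<^sub>R (indicator (ball s r) x *\<^sub>R x))" for x
    by (simp add: g_def sum_distrib_left scaleR_sum_left mult.assoc)
  have g_int: "integrable M (\<lambda>x. g x *\<^sub>R x)"
    unfolding g_eq by (intro Bochner_Integration.integrable_sum integrable_scaleR_right int_ball)
  have "(\<integral>x. g x *\<^sub>R x \<partial>M)
      = (\<Sum>s\<in>T - {p}. (c * a s) *\<^sub>R (\<integral>x. indicator (ball s r) x *\<^sub>R x \<partial>M))"
    unfolding g_eq using int_ball
    by (subst Bochner_Integration.integral_sum) (auto simp del: scaleR_scaleR)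
  also have "\<dots> = c *\<^sub>R (\<Sum>s\<in>T - {p}. a s *\<^sub>R (\<integral>x. indicator (ball s r) x *\<^sub>R x \<partial>M))"
    by (simp add: scaleR_sum_right)
  finally have g_bary: "(\<integral>x. g x *\<^sub>R x \<partial>M) = 0" using rel by simp
  have bary: "(\<integral>x. x \<partial>M) = 0" using M by (auto simp: alexandrov_measures_def)
  \<comment> \<open>The sign \<open>\<sigma>\<close> treats both halves of the splitting at once.\<close>
  have half: "density M (\<lambda>x. ennreal (1 / 2 + \<sigma> * g x)) \<in> alexandrov_measures"
    if "\<bar>\<sigma>\<bar> = 1" for \<sigma> :: real
  proof (rule alexandrov_density[OF M])
    have bd: "\<bar>\<sigma> * g x\<bar> \<le> 1 / 4" for x using g_bound[of x] that by (simp add: abs_mult)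
    show "0 < 1 / 2 + \<sigma> * g x" "1 / 2 + \<sigma> * g x \<le> 1" for x
      using bd[of x] by linarith+
    show "(\<lambda>x. 1 / 2 + \<sigma> * g x) \<in> borel_measurable borel" using g_meas by measurable
    have "(\<integral>x. (1 / 2 + \<sigma> * g x) *\<^sub>R x \<partial>M)
        = (\<integral>x. (1 / 2) *\<^sub>R x + \<sigma> *\<^sub>R (g x *\<^sub>R x) \<partial>M)"
      by (simp add: scaleR_add_left)
    also have "\<dots> = (\<integral>x. (1 / 2) *\<^sub>R x \<partial>M) + (\<integral>x. \<sigma> *\<^sub>R (g x *\<^sub>R x) \<partial>M)"
      by (intro Bochner_Integration.integral_add integrable_scaleR_right g_int
          integrable_id_sphere MS)
    also have "\<dots> = 0" using g_bary bary by (simp del: scaleR_scaleR)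
    finally show "(\<integral>x. (1 / 2 + \<sigma> * g x) *\<^sub>R x \<partial>M) = 0" .
  qed
  define N1 where "N1 = density M (\<lambda>x. ennreal (1 / 2 + 1 * g x))"
  define N2 where "N2 = density M (\<lambda>x. ennreal (1 / 2 + (- 1) * g x))"
  have gM: "g \<in> borel_measurable M" by (rule MD(4)[OF g_meas])
  have N_alex: "N1 \<in> alexandrov_measures" "N2 \<in> alexandrov_measures"
    unfolding N1_def N2_def by (rule half; simp)+
  have sets_N: "sets N2 = sets N1" "sets N1 = sets M" by (simp_all add: N1_def N2_def)
  have split: "M = add_measure N1 N2"
  proof (rule measure_eqI)
    show "sets M = sets (add_measure N1 N2)" by (simp add: sets_N)
    fix A assume A: "A \<in> sets M"
    have "ennreal (1 / 2 + 1 * g x) + ennreal (1 / 2 + (- 1) * g x) = 1" for x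
      using g_bound[of x] by (subst ennreal_plus[symmetric]) (auto simp: abs_le_iff)
    then have "emeasure M A = (\<integral>\<^sup>+x. (ennreal (1 / 2 + 1 * g x)
        + ennreal (1 / 2 + (- 1) * g x)) * indicator A x \<partial>M)"
      using A by simp
    also have "\<dots> = emeasure N1 A + emeasure N2 A"
      using gM A unfolding N1_def N2_def
      by (simp add: emeasure_density distrib_right nn_integral_add)
    finally show "emeasure M A = emeasure (add_measure N1 N2) A"
      by (simp add: emeasure_add_measure sets_N)
  qed
  have const: "emeasure N1 (B s) = ennreal ((1 / 2 + k) * measure M (B s))"
    if "\<And>x. x \<in> B s \<Longrightarrow> g x = k" "\<bar>k\<bar> \<le> 1 / 4" for s k
  proof -
    have "emeasure N1 (B s) = (\<integral>\<^sup>+x. ennreal (1 / 2 + k) * indicator (B s) x \<partial>M)"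
      using gM B_sets that(1) unfolding N1_def
      by (auto simp: emeasure_density intro!: nn_integral_cong split: split_indicator)
    also have "\<dots> = ennreal (1 / 2 + k) * emeasure M (B s)"
      by (rule nn_integral_cmult_indicator[OF B_sets])
    finally show ?thesis using that(2) by (simp add: emeasure_eq_measure ennreal_mult')
  qed
  have "\<nexists>t. t > 0 \<and> N1 = scale_measure (ennreal t) M"
  proof
    assume "\<exists>t. t > 0 \<and> N1 = scale_measure (ennreal t) M"
    then obtain t where t: "t > 0" "N1 = scale_measure (ennreal t) M" by auto
    have eq: "1 / 2 + k = t"
      if "s \<in> T" "\<And>x. x \<in> B s \<Longrightarrow> g x = k" "\<bar>k\<bar> \<le> 1 / 4" for s k
    proof -
      have "ennreal ((1 / 2 + k) * measure M (B s)) = ennreal (t * measure M (B s))"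
        using const[OF that(2,3)] t by (simp add: emeasure_eq_measure ennreal_mult')
      then have "(1 / 2 + k) * measure M (B s) = t * measure M (B s)"
        using t that(3) by (subst (asm) ennreal_inj) (auto simp: abs_le_iff)
      then show ?thesis using B_pos[OF that(1)] by simp
    qed
    have "B q \<noteq> {}" using B_pos[of q] q by auto
    then have "\<bar>c * a q\<bar> \<le> 1 / 4" using g_q g_bound by (metis ex_in_conv)
    then have "1 / 2 + c * a q = 1 / 2 + 0"
      using eq[of q "c * a q"] eq[of p 0] g_q g_p p q by auto
    then show False using c(1) q(2) by simp
  qed
  with N_alex split show ?thesis by blast
qed

lemma alexandrov_indecomposable_iff:
  fixes M :: "'a::euclidean_space measure"
  assumes M: "M \<in> alexandrov_measures"
  shows "(\<forall>N1\<in>alexandrov_measures. \<forall>N2\<in>alexandrov_measures. M = add_measure N1 N2 \<longrightarrow>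
      (\<exists>t>0. N1 = scale_measure (ennreal t) M) \<and> (\<exists>t>0. N2 = scale_measure (ennreal t) M)) \<longleftrightarrow>
    finite (measure_support M) \<and> card (measure_support M) = DIM('a) + 1"
    (is "?indec \<longleftrightarrow> ?simplex")
proof
  assume indec: ?indec
  have small: "\<not> (T \<subseteq> measure_support M \<and> finite T \<and> card T = DIM('a) + 2)" for T
    using alexandrov_decomposition_of_large_support[OF M, of T] indec by blast
  have fin: "finite (measure_support M)"
    using small infinite_arbitrarily_large by blast
  moreover have "\<not> card (measure_support M) \<ge> DIM('a) + 2"
    using small obtain_subset_with_card_n by metis
  ultimately show ?simplex using alexandrov_support_lower_bound[OF M fin] by simp
next
  assume ?simplex
  then have S: "finite (measure_support M)" "card (measure_support M) = DIM('a) + 1" by auto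
  show ?indec
  proof (intro ballI impI conjI)
    fix N1 N2 :: "'a measure"
    assume N: "N1 \<in> alexandrov_measures" "N2 \<in> alexandrov_measures"
      and sum: "M = add_measure N1 N2"
    have "sets N2 = sets N1"
      using N by (auto simp: alexandrov_measures_def sphere_measures_def)
    then have "emeasure M A = emeasure N1 A + emeasure N2 A" for A
      unfolding sum by (rule emeasure_add_measure)
    then have "emeasure N1 A \<le> emeasure M A" "emeasure N2 A \<le> emeasure M A" for A by simp_all
    then show "\<exists>t>0. N1 = scale_measure (ennreal t) M" "\<exists>t>0. N2 = scale_measure (ennreal t) M"
      using N alexandrov_summand_of_simplex_support[OF M S] by blast+
  qed
qed

section \<open>From bodies to measures\<close>

lemma param_addE:
  assumes \<mu>: "parametrization \<mu>" and K: "K \<in> convex_bodies" "L \<in> convex_bodies"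
  shows "param_add \<mu> K L \<in> convex_bodies \<and> \<mu> (param_add \<mu> K L) = add_measure (\<mu> K) (\<mu> L)"
proof -
  have cone: "\<forall>\<nu>1\<in>\<mu> ` convex_bodies. \<forall>\<nu>2\<in>\<mu> ` convex_bodies. \<forall>t1 t2::real. t1 > 0 \<longrightarrow> t2 > 0 \<longrightarrow>
      add_measure (scale_measure (ennreal t1) \<nu>1) (scale_measure (ennreal t2) \<nu>2)
        \<in> \<mu> ` convex_bodies"
    using \<mu> by (simp add: parametrization_def)
  have "add_measure (scale_measure (ennreal 1) (\<mu> K)) (scale_measure (ennreal 1) (\<mu> L))
      \<in> \<mu> ` convex_bodies"
    using K by (intro cone[rule_format]) auto
  then have "\<exists>M. M \<in> convex_bodies \<and> \<mu> M = add_measure (\<mu> K) (\<mu> L)" by auto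
  then show ?thesis unfolding param_add_def by (rule someI_ex)
qed

text \<open>The cone property only speaks of sums, so \<open>t \<nu>\<close> is obtained as \<open>(t/2) \<nu> + (t/2) \<nu>\<close>.\<close>

lemma param_scaleE:
  assumes \<mu>: "parametrization \<mu>" and K: "K \<in> convex_bodies" and t: "t > 0"
  shows "param_scale \<mu> t K \<in> convex_bodies
    \<and> \<mu> (param_scale \<mu> t K) = scale_measure (ennreal t) (\<mu> K)"
proof -
  have cone: "\<forall>\<nu>1\<in>\<mu> ` convex_bodies. \<forall>\<nu>2\<in>\<mu> ` convex_bodies. \<forall>t1 t2::real. t1 > 0 \<longrightarrow> t2 > 0 \<longrightarrow>
      add_measure (scale_measure (ennreal t1) \<nu>1) (scale_measure (ennreal t2) \<nu>2)
        \<in> \<mu> ` convex_bodies"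
    using \<mu> by (simp add: parametrization_def)
  have "add_measure (scale_measure (ennreal (t / 2)) (\<mu> K))
      (scale_measure (ennreal (t / 2)) (\<mu> K)) \<in> \<mu> ` convex_bodies"
    using K t by (intro cone[rule_format]) auto
  also have "add_measure (scale_measure (ennreal (t / 2)) (\<mu> K))
      (scale_measure (ennreal (t / 2)) (\<mu> K)) = scale_measure (ennreal t) (\<mu> K)"
    using t by (intro measure_eqI)
      (auto simp: emeasure_add_measure distrib_right[symmetric] ennreal_plus[symmetric]
        simp del: ennreal_plus)
  finally have "\<exists>M. M \<in> convex_bodies \<and> \<mu> M = scale_measure (ennreal t) (\<mu> K)" by force
  then show ?thesis unfolding param_scale_def by (rule someI_ex)
qed

lemma param_indecomposable_iff_measures:
  assumes \<mu>: "parametrization \<mu>" and K: "K \<in> convex_bodies"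
  shows "param_indecomposable \<mu> K \<longleftrightarrow>
    (\<forall>N1\<in>\<mu> ` convex_bodies. \<forall>N2\<in>\<mu> ` convex_bodies. \<mu> K = add_measure N1 N2 \<longrightarrow>
      (\<exists>t>0. N1 = scale_measure (ennreal t) (\<mu> K)) \<and>
      (\<exists>t>0. N2 = scale_measure (ennreal t) (\<mu> K)))"
proof -
  have inj: "translates K1 K2 \<longleftrightarrow> \<mu> K1 = \<mu> K2"
    if "K1 \<in> convex_bodies" "K2 \<in> convex_bodies" for K1 K2
    using \<mu> that by (simp add: parametrization_def)
  have add: "translates K (param_add \<mu> K1 K2) \<longleftrightarrow> \<mu> K = add_measure (\<mu> K1) (\<mu> K2)"
    if "K1 \<in> convex_bodies" "K2 \<in> convex_bodies" for K1 K2
    using param_addE[OF \<mu> that] inj[OF K] by simp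
  have scale: "translates K1 (param_scale \<mu> t K) \<longleftrightarrow> \<mu> K1 = scale_measure (ennreal t) (\<mu> K)"
    if "K1 \<in> convex_bodies" "t > 0" for K1 t
    using param_scaleE[OF \<mu> K that(2)] inj[OF that(1)] by simp
  show ?thesis
    by (simp add: param_indecomposable_def add scale cong: ball_cong conj_cong)
qed

theorem theorem3p13:
  fixes \<mu> :: "(real ^ 'n) set \<Rightarrow> (real ^ 'n) measure" and K :: "(real ^ 'n) set"
  assumes "parametrization \<mu>"
    and "\<mu> ` convex_bodies = alexandrov_measures"
    and "K \<in> convex_bodies"
  shows "param_indecomposable \<mu> K \<longleftrightarrow>
    finite (measure_support (\<mu> K)) \<and> card (measure_support (\<mu> K)) = CARD('n) + 1"
proof -
  have "\<mu> K \<in> alexandrov_measures" using assms(2,3) by blast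
  from alexandrov_indecomposable_iff[OF this] show ?thesis
    by (simp add: param_indecomposable_iff_measures[OF assms(1,3)] assms(2))
qed

end
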